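(* For every integer $n\ge 0$, $$\sum_{p=0}^{\lfloor n/2\rfloor}\frac{1}{2p+1}\binom{3p}{p}\binom{n+p}{3p}=\frac{1}{n+1}\binom{2n}{n},$$ and for every integer $n\ge 1$, $$\sum_{p=0}^{\lfloor (n-1)/2\rfloor}\frac{1}{2p+1}\binom{3p+1}{p+1}\binom{n+p}{3p+1}=\frac{1}{n+1}\binom{2n}{n}.$$ *)

theory Defs
  imports Complex_Main
begin

end

theory Submission
  imports Defs "HOL-Computational_Algebra.Formal_Power_Series"
begin

text \<open>
  Comparing coefficients of $x^k$ in
  $(1 - x^2)^{-(m+1)} (1 + x)^{m+1} = (1 - x)^{-(m+1)}$ gives
  $\sum_q {m+q \choose m} {m+1 \choose k-2q} = {m+k \choose m}$.
  After cancelling factorials, the first identity is the case $m = k = n$ divided by $n + 1$, and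
  the second is the case $m = n - 1$, $k = n + 1$, $q = p + 1$ divided by $n$; there the term
  $q = 0$ vanishes and the right-hand side is ${2n \choose n-1} / n$.
\<close>

unbundle fps_syntax

text \<open>Induction on \<open>m\<close>: the base case is the geometric series in
  \<open>fps_X ^ d\<close>, and each further factor \<open>1 - fps_X ^ d\<close> lowers
  \<open>m\<close> by one. A general \<open>d\<close> covers both cases needed later,
  \<open>d = 1\<close> and \<open>d = 2\<close>.\<close>

lemma fps_one_minus_X_power_neg_power:
  assumes "d > 0"
  shows "Abs_fps (\<lambda>k. if d dvd k then of_nat ((m + k div d) choose m) else 0)
           * (1 - fps_X ^ d) ^ Suc m = (1 :: 'a :: comm_ring_1 fps)"
proof (induction m)
  case 0
  show ?case
  proof (rule fps_ext)
    fix k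
    show "(Abs_fps (\<lambda>k. if d dvd k then of_nat ((0 + k div d) choose 0) else 0)
           * (1 - fps_X ^ d) ^ Suc 0) $ k = (1 :: 'a fps) $ k"
      using assms
      by (auto simp: algebra_simps fps_X_power_mult_nth dvd_minus_self dest: dvd_imp_le)
  qed
next
  case (Suc m)
  let ?A = "\<lambda>m. Abs_fps (\<lambda>k. if d dvd k then of_nat ((m + k div d) choose m) else 0) :: 'a fps"
  \<comment> \<open>At \<open>k = d * j\<close> with \<open>j > 0\<close> this is Pascal's rule:
    (m+1+j choose m+1) - (m+j choose m+1) = (m+j choose m). For \<open>j = 0\<close> the shifted
    term is absent and both sides are 1.\<close>
  have "?A (Suc m) * (1 - fps_X ^ d) = ?A m"
  proof (rule fps_ext)
    fix k
    show "(?A (Suc m) * (1 - fps_X ^ d)) $ k = ?A m $ k"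
    proof (cases "d dvd k")
      case True
      then obtain j where k: "k = d * j" by blast
      show ?thesis
      proof (cases j)
        case (Suc i)
        then have "k - d = d * i" "\<not> k < d" by (auto simp: k)
        then show ?thesis
          using assms Suc by (simp add: k algebra_simps fps_X_power_mult_nth)
      qed (use assms in \<open>simp add: k algebra_simps fps_X_power_mult_nth\<close>)
    qed (simp add: algebra_simps fps_X_power_mult_nth dvd_minus_self)
  qed
  then show ?case
    using Suc.IH by (simp only: power_Suc[of _ "Suc m"] flip: mult.assoc)
qed

lemma fps_one_plus_X_power_nth:
  "((1 + fps_X) ^ n :: 'a :: comm_ring_1 fps) $ k = of_nat (n choose k)"
proof (induction n arbitrary: k)
  case (Suc n)
  then show ?case
    by (cases k) (simp_all add: algebra_simps)
qed (auto simp: gr0_conv_Suc)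

lemma sum_choose_mult_choose_diff_double:
  "(\<Sum>q = 0..k div 2. ((m + q) choose m) * (Suc m choose (k - 2 * q))) = (m + k) choose m"
proof -
  \<comment> \<open>Integer coefficients make the power series an integral domain, which permits the
    cancellation below.\<close>
  define A :: "nat \<Rightarrow> int fps"
    where "A d = Abs_fps (\<lambda>k. if d dvd k then of_nat ((m + k div d) choose m) else 0)" for d
  have A: "A d * (1 - fps_X ^ d) ^ Suc m = 1" if "d > 0" for d
    using fps_one_minus_X_power_neg_power[OF that] by (simp add: A_def)
  have "(1 - fps_X ^ 2 :: int fps) = (1 - fps_X ^ 1) * (1 + fps_X)"
    by (simp add: algebra_simps power2_eq_square)
  \<comment> \<open>So \<open>A 2 * (1 + fps_X) ^ Suc m\<close> and \<open>A 1\<close> are both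
    inverse to the same power of \<open>1 - fps_X\<close>. That power is nonzero, since its product
    with \<open>A 1\<close> is 1.\<close>
  then have "A 2 * (1 + fps_X) ^ Suc m * (1 - fps_X ^ 1) ^ Suc m = 1"
    using A[of 2] by (simp add: power_mult_distrib mult_ac del: power_Suc)
  also have "\<dots> = A 1 * (1 - fps_X ^ 1) ^ Suc m"
    using A[of 1] by simp
  finally have A_eq: "A 2 * (1 + fps_X) ^ Suc m = A 1"
    by (rule mult_right_cancel[THEN iffD1, rotated]) (use A[of 1] in auto)
  have "(\<Sum>q = 0..k div 2. int ((m + q) choose m) * int (Suc m choose (k - 2 * q)))
      = (\<Sum>i \<in> (*) 2 ` {0..k div 2}. A 2 $ i * ((1 + fps_X) ^ Suc m) $ (k - i))"
    by (subst sum.reindex) (auto simp: inj_on_def A_def fps_one_plus_X_power_nth simp del: power_Suc binomial_Suc_Suc)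
  \<comment> \<open>\<open>A 2\<close> vanishes at odd indices, so the even ones carry the whole
    convolution.\<close>
  also have "\<dots> = (\<Sum>i = 0..k. A 2 $ i * ((1 + fps_X) ^ Suc m) $ (k - i))"
    by (rule sum.mono_neutral_left) (auto simp: A_def image_iff elim!: dvdE)
  also have "\<dots> = A 1 $ k"
    by (simp only: fps_mult_nth A_eq[symmetric])
  finally show ?thesis
    by (simp add: A_def flip: of_nat_mult of_nat_sum del: binomial_Suc_Suc)
qed

theorem corollary5p8:
  shows "(\<forall>n::nat.
            (\<Sum>p = 0..n div 2.
               1 / real (2 * p + 1) * real ((3 * p) choose p) * real ((n + p) choose (3 * p)))
            = 1 / real (n + 1) * real ((2 * n) choose n))
       \<and> (\<forall>n::nat. n \<ge> 1 \<longrightarrow>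
            (\<Sum>p = 0..(n - 1) div 2.
               1 / real (2 * p + 1) * real ((3 * p + 1) choose (p + 1)) * real ((n + p) choose (3 * p + 1)))
            = 1 / real (n + 1) * real ((2 * n) choose n))"
proof (intro conjI allI impI)
  fix n :: nat
  \<comment> \<open>Both sides equal (n+p)! / (p! (2p+1)! (n-2p)!). Writing
    \<open>n = r + 2 * p\<close> removes the truncated subtraction.\<close>
  have "1 / real (2 * p + 1) * real ((3 * p) choose p) * real ((n + p) choose (3 * p))
      = 1 / real (n + 1) * real (((n + p) choose n) * (Suc n choose (n - 2 * p)))"
    if "p \<in> {0..n div 2}" for p
  proof -
    define r where "r = n - 2 * p"
    have n: "n = r + 2 * p" using that by (auto simp: r_def)
    have "3 * p - p = 2 * p" "n + p - 3 * p = r" "Suc n - r = Suc (2 * p)"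
      by (simp_all add: n)
    then show ?thesis
      unfolding r_def[symmetric]
      by (simp add: binomial_fact n field_simps del: binomial_Suc_Suc of_nat_Suc)
  qed
  then have "(\<Sum>p = 0..n div 2.
               1 / real (2 * p + 1) * real ((3 * p) choose p) * real ((n + p) choose (3 * p)))
      = 1 / real (n + 1) * real (\<Sum>p = 0..n div 2. ((n + p) choose n) * (Suc n choose (n - 2 * p)))"
    unfolding of_nat_sum sum_distrib_left by (intro sum.cong refl)
  then show "(\<Sum>p = 0..n div 2.
               1 / real (2 * p + 1) * real ((3 * p) choose p) * real ((n + p) choose (3 * p)))
            = 1 / real (n + 1) * real ((2 * n) choose n)"
    by (simp only: sum_choose_mult_choose_diff_double mult_2[of n])
next
  fix n :: nat
  assume "n \<ge> 1"
  then obtain m where m: "n = Suc m" by (cases n) auto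
  let ?f = "\<lambda>q. ((m + q) choose m) * (n choose (n + 1 - 2 * q))"
  \<comment> \<open>Both sides equal (n+p)! / ((p+1)! (2p+1)! (n-1-2p)!).\<close>
  have "1 / real (2 * p + 1) * real ((3 * p + 1) choose (p + 1)) * real ((n + p) choose (3 * p + 1))
      = 1 / real n * real (?f (Suc p))"
    if "p \<in> {0..(n - 1) div 2}" for p
  proof -
    define r where "r = m - 2 * p"
    have n: "m = r + 2 * p" using that by (auto simp: r_def m)
    have "3 * p + 1 - (p + 1) = 2 * p" "n + p - (3 * p + 1) = r" "n + 1 - 2 * Suc p = r" 
      "n - r = Suc (2 * p)" by (simp_all add: n m)
    then show ?thesis
      by (simp add: binomial_fact n m field_simps del: binomial_Suc_Suc of_nat_Suc)
  qed
  then have "(\<Sum>p = 0..(n - 1) div 2.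
               1 / real (2 * p + 1) * real ((3 * p + 1) choose (p + 1)) * real ((n + p) choose (3 * p + 1)))
      = 1 / real n * real (\<Sum>p = 0..(n - 1) div 2. ?f (Suc p))"
    unfolding of_nat_sum sum_distrib_left by (intro sum.cong refl)
  also have "(\<Sum>p = 0..(n - 1) div 2. ?f (Suc p)) = (\<Sum>q = 0..(n + 1) div 2. ?f q)"
  proof -
    have "(n + 1) div 2 = Suc ((n - 1) div 2)" using m by simp
    \<comment> \<open>The second factor is \<open>n choose (n + 1)\<close>.\<close>
    moreover have "?f 0 = 0" by simp
    ultimately show ?thesis
      by (simp only: sum.atLeast0_atMost_Suc_shift add_0 o_def)
  qed
  also have "\<dots> = (2 * n) choose m"
    using sum_choose_mult_choose_diff_double[of m "n + 1"] by (simp add: m mult_2)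
  \<comment> \<open>Both sides equal (2n)! / (n! (n+1)!).\<close>
  also have "1 / real n * real ((2 * n) choose m) = 1 / real (n + 1) * real ((2 * n) choose n)"
  proof -
    have "2 * n - m = Suc (Suc m)" "2 * n - n = Suc m" by (simp_all add: m)
    then show ?thesis
      by (simp add: binomial_fact m field_simps del: binomial_Suc_Suc of_nat_Suc)
  qed
  finally show "(\<Sum>p = 0..(n - 1) div 2.
               1 / real (2 * p + 1) * real ((3 * p + 1) choose (p + 1)) * real ((n + p) choose (3 * p + 1)))
            = 1 / real (n + 1) * real ((2 * n) choose n)" .
qed

end
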